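(* There is an algorithm that, given a deducibility constraint system $C$ (in which some fixed name belongs to the left side of every constraint), decides whether $C$ is satisfiable.
   Context: Messages are built from countably infinite sets of names and variables using only pairing $\langle M,N\rangle$ and symmetric encryption $\{M\}_N$; equality is syntactic. $V(\cdot)$ is the set of variables occurring in an object; a message is ground if variable-free. Sequent rules ($\Gamma,M$ means $\Gamma\cup\{M\}$): (id) $\Gamma\vdash M$ if $M\in\Gamma$; ($p_L$) from $\Gamma,\langle M,N\rangle,M,N\vdash T$ infer $\Gamma,\langle M,N\rangle\vdash T$; ($p_R$) from $\Gamma\vdash M$, $\Gamma\vdash N$ infer $\Gamma\vdash\langle M,N\rangle$; ($e_L$) from $\Gamma,\{M\}_K\vdash K$ and $\Gamma,\{M\}_K,M,K\vdash N$ infer $\Gamma,\{M\}_K\vdash N$; ($e_R$) from $\Gamma\vdash M$, $\Gamma\vdash K$ infer $\Gamma\vdash\{M\}_K$. $\Gamma\Vdash M$: derivable; $\Gamma\Vdash_R M$: derivable using only id, $p_R$, $e_R$; $\Gamma\Vdash\Delta$: $\Gamma\Vdash N$ for all $N\in\Delta$. A deducibility constraint is $\Sigma\Vdash^? M$ (proper) or $\Sigma\Vdash^?_R M$ (right), with $\Sigma$ a finite set of messages. Substitutions are applied postfix; a ground substitution $\theta$ is a solution of a list $C$ of constraints if $\Sigma\theta\Vdash M\theta$ for each proper and $\Sigma\theta\Vdash_R M\theta$ for each right constraint of $C$; $C$ is satisfiable if it has a solution. $C^i$ is the prefix of $C$ of length $i-1$. A deducibility constraint system is a list $\Sigma_1\Vdash^?_{(R)}M_1;\cdots;\Sigma_n\Vdash^?_{(R)}M_n$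 (each proper or right) such that: (1) for all $i<j$, if $\Sigma_j^{dv}$ is $\Sigma_j$ with all messages deleted that contain a variable occurring in no message of $\Sigma_i$, then every solution $\theta$ of $C^j$ satisfies $\Sigma_j^{dv}\theta\Vdash\Sigma_i\theta$; (2) for every $x\in V(C)$ there is $i$ with $x\in V(M_i)$, $x\notin V(\Sigma_i)$, and $x$ occurring in no constraint with index $j<i$. *)

theory Defs
  imports Main "HOL-Library.Nat_Bijection"
begin

section \<open>Messages\<close>

text \<open>\<open>Enc M K\<close> is the encryption of \<open>M\<close> under the key \<open>K\<close>.  Names and variables are
  indexed by natural numbers.\<close>

datatype msg =
    Name nat
  | Var nat
  | Pair msg msg
  | Enc msg msg

primrec vars :: "msg \<Rightarrow> nat set" where
  "vars (Name a) = {}"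
| "vars (Var x) = {x}"
| "vars (Pair M N) = vars M \<union> vars N"
| "vars (Enc M K) = vars M \<union> vars K"

definition vars_set :: "msg set \<Rightarrow> nat set" where
  "vars_set S = (\<Union>M\<in>S. vars M)"

definition ground :: "msg \<Rightarrow> bool" where
  "ground M \<longleftrightarrow> vars M = {}"

type_synonym subst = "nat \<Rightarrow> msg"

primrec subst :: "subst \<Rightarrow> msg \<Rightarrow> msg" where
  "subst \<theta> (Name a) = Name a"
| "subst \<theta> (Var x) = \<theta> x"
| "subst \<theta> (Pair M N) = Pair (subst \<theta> M) (subst \<theta> N)"
| "subst \<theta> (Enc M K) = Enc (subst \<theta> M) (subst \<theta> K)"

text \<open>A ground substitution is represented as a total map to ground messages; only its values
  on the finitely many variables of the constraints at hand matter.\<close>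

definition ground_subst :: "subst \<Rightarrow> bool" where
  "ground_subst \<theta> \<longleftrightarrow> (\<forall>x. ground (\<theta> x))"


section \<open>Sequent calculus\<close>

inductive derivable :: "msg set \<Rightarrow> msg \<Rightarrow> bool" (infix "\<turnstile>" 50) where
  id: "M \<in> \<Gamma> \<Longrightarrow> \<Gamma> \<turnstile> M"
| pL: "\<Gamma> \<union> {Pair M N, M, N} \<turnstile> T \<Longrightarrow> \<Gamma> \<union> {Pair M N} \<turnstile> T"
| pR: "\<Gamma> \<turnstile> M \<Longrightarrow> \<Gamma> \<turnstile> N \<Longrightarrow> \<Gamma> \<turnstile> Pair M N"
| eL: "\<Gamma> \<union> {Enc M K} \<turnstile> K \<Longrightarrow> \<Gamma> \<union> {Enc M K, M, K} \<turnstile> N \<Longrightarrow> \<Gamma> \<union> {Enc M K} \<turnstile> N"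
| eR: "\<Gamma> \<turnstile> M \<Longrightarrow> \<Gamma> \<turnstile> K \<Longrightarrow> \<Gamma> \<turnstile> Enc M K"

inductive derivable_right :: "msg set \<Rightarrow> msg \<Rightarrow> bool" (infix "\<turnstile>\<^sub>R" 50) where
  id: "M \<in> \<Gamma> \<Longrightarrow> \<Gamma> \<turnstile>\<^sub>R M"
| pR: "\<Gamma> \<turnstile>\<^sub>R M \<Longrightarrow> \<Gamma> \<turnstile>\<^sub>R N \<Longrightarrow> \<Gamma> \<turnstile>\<^sub>R Pair M N"
| eR: "\<Gamma> \<turnstile>\<^sub>R M \<Longrightarrow> \<Gamma> \<turnstile>\<^sub>R K \<Longrightarrow> \<Gamma> \<turnstile>\<^sub>R Enc M K"


section \<open>Deducibility constraint systems\<close>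

datatype constr =
    Proper (lhs: "msg set") (rhs: msg)
  | Right (lhs: "msg set") (rhs: msg)

definition vars_constr :: "constr \<Rightarrow> nat set" where
  "vars_constr c = vars_set (lhs c) \<union> vars (rhs c)"

primrec solves_constr :: "subst \<Rightarrow> constr \<Rightarrow> bool" where
  "solves_constr \<theta> (Proper S M) \<longleftrightarrow> subst \<theta> ` S \<turnstile> subst \<theta> M"
| "solves_constr \<theta> (Right S M) \<longleftrightarrow> subst \<theta> ` S \<turnstile>\<^sub>R subst \<theta> M"

definition solution :: "subst \<Rightarrow> constr list \<Rightarrow> bool" where
  "solution \<theta> C \<longleftrightarrow> ground_subst \<theta> \<and> (\<forall>c\<in>set C. solves_constr \<theta> c)"

definition satisfiable :: "constr list \<Rightarrow> bool" where
  "satisfiable C \<longleftrightarrow> (\<exists>\<theta>. solution \<theta> C)"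

text \<open>The messages of \<open>S'\<close> all of whose variables occur in \<open>S\<close>.\<close>

definition delete_vars :: "msg set \<Rightarrow> msg set \<Rightarrow> msg set" where
  "delete_vars S' S = {M \<in> S'. vars M \<subseteq> vars_set S}"

text \<open>Positions are counted from 0, so the constraints strictly before position \<open>j\<close> are
  \<open>take j C\<close>.\<close>

definition deducibility_constraint_system :: "constr list \<Rightarrow> bool" where
  "deducibility_constraint_system C \<longleftrightarrow>
     (\<forall>c\<in>set C. finite (lhs c)) \<and>
     (\<forall>i j. i < j \<and> j < length C \<longrightarrow>
        (\<forall>\<theta>. solution \<theta> (take j C) \<longrightarrow>
           (\<forall>N\<in>subst \<theta> ` lhs (C ! i).
              subst \<theta> ` delete_vars (lhs (C ! j)) (lhs (C ! i)) \<turnstile> N))) \<and>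
     (\<forall>x\<in>(\<Union>c\<in>set C. vars_constr c). \<exists>i<length C.
        x \<in> vars (rhs (C ! i)) \<and> x \<notin> vars_set (lhs (C ! i)) \<and>
        (\<forall>j<i. x \<notin> vars_constr (C ! j)))"


section \<open>Algorithms: partial recursive functions\<close>

datatype recf =
    Zero
  | Succ
  | Proj nat
  | Comp recf "recf list"
  | PrimRec recf recf
  | Mu recf

text \<open>\<^term>\<open>None\<close> means divergence, or that the number of arguments does not fit.
  \<open>Zero\<close> is the constant 0 of any arity.  Composition is strict.  In \<open>PrimRec f g\<close> the
  recursion argument comes first, and \<open>g\<close> receives the predecessor, the previous value and the
  parameters.  \<open>Mu f\<close> returns the least zero of \<open>f\<close> in its first argument, provided that \<open>f\<close>
  converges on all smaller arguments.\<close>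

fun run :: "recf \<Rightarrow> nat list \<Rightarrow> nat option" where
  "run Zero xs = Some 0"
| "run Succ xs = (case xs of [x] \<Rightarrow> Some (Suc x) | _ \<Rightarrow> None)"
| "run (Proj i) xs = (if i < length xs then Some (xs ! i) else None)"
| "run (Comp f gs) xs = Option.bind (those (map (\<lambda>g. run g xs) gs)) (run f)"
| "run (PrimRec f g) xs =
     (case xs of
        [] \<Rightarrow> None
      | n # ys \<Rightarrow>
          rec_nat (run f ys) (\<lambda>m r. Option.bind r (\<lambda>v. run g (m # v # ys))) n)"
| "run (Mu f) xs =
     (let least_zero = (\<lambda>n. run f (n # xs) = Some 0 \<and>
                            (\<forall>m<n. \<exists>v. run f (m # xs) = Some v \<and> v \<noteq> 0))
      in if \<exists>n. least_zero n then Some (THE n. least_zero n) else None)"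


section \<open>Encoding of the input as a natural number\<close>

primrec msg_code :: "msg \<Rightarrow> nat" where
  "msg_code (Name a) = prod_encode (0, a)"
| "msg_code (Var x) = prod_encode (1, x)"
| "msg_code (Pair M N) = prod_encode (2, prod_encode (msg_code M, msg_code N))"
| "msg_code (Enc M K) = prod_encode (3, prod_encode (msg_code M, msg_code K))"

primrec constr_code :: "constr \<Rightarrow> nat" where
  "constr_code (Proper S M) =
     prod_encode (0, prod_encode (set_encode (msg_code ` S), msg_code M))"
| "constr_code (Right S M) =
     prod_encode (1, prod_encode (set_encode (msg_code ` S), msg_code M))"

definition system_code :: "constr list \<Rightarrow> nat" where
  "system_code C = list_encode (map constr_code C)"

lemma inj_msg_code: "inj msg_code"
proof (rule injI)
  show "M = N" if "msg_code M = msg_code N" for M N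
    using that
  proof (induction M arbitrary: N)
    case (Name a) then show ?case by (cases N) auto
  next
    case (Var x) then show ?case by (cases N) auto
  next
    case (Pair M1 M2) then show ?case by (cases N) auto
  next
    case (Enc M1 M2) then show ?case by (cases N) auto
  qed
qed

lemma constr_code_inj_on: "inj_on constr_code {c. finite (lhs c)}"
proof (rule inj_onI)
  fix c d
  assume fin: "c \<in> {c. finite (lhs c)}" "d \<in> {c. finite (lhs c)}"
    and eq: "constr_code c = constr_code d"
  have sets: "S = T" if "finite S" "finite T"
    "set_encode (msg_code ` S) = set_encode (msg_code ` T)" for S T
    using that by (simp add: set_encode_eq inj_image_eq_iff inj_msg_code)
  show "c = d"
    using fin eq by (cases c; cases d) (auto dest: sets injD[OF inj_msg_code])
qed

lemma system_code_inj_on: "inj_on system_code {C. \<forall>c\<in>set C. finite (lhs c)}"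
proof (rule inj_onI)
  fix C D
  assume fin: "C \<in> {C. \<forall>c\<in>set C. finite (lhs c)}" "D \<in> {C. \<forall>c\<in>set C. finite (lhs c)}"
    and eq: "system_code C = system_code D"
  from eq have "map constr_code C = map constr_code D"
    by (simp add: system_code_def list_encode_eq)
  moreover have "inj_on constr_code (set C \<union> set D)"
    by (rule inj_on_subset[OF constr_code_inj_on]) (use fin in auto)
  ultimately show "C = D"
    by (simp add: inj_on_map_eq_map)
qed

end

theory Submission
  imports Defs
begin

text \<open>A solution \<open>\<theta>\<close> of minimal weight maps every variable \<open>x\<close> of \<open>C\<close> to an instance \<open>u\<theta>\<close> of a
  non-variable subterm \<open>u\<close> of \<open>C\<close>: otherwise, replacing \<open>x\<theta>\<close> by the common name \<open>a\<close> everywhere in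
  \<open>\<theta>\<close> gives a lighter solution.  Such a \<open>\<theta>\<close> is determined by the finite map from variables to
  subterms, so that finitely many candidates have to be tested; a test amounts to ground
  derivability, which is decidable since derivations may be confined to subterms.  This procedure
  is a composition of operations on lists and messages under which computability is closed.\<close>

text \<open>Condition (1) speaks only of solutions of a prefix, so it cannot be invoked for the
  modified substitution all at once: that substitution is shown to solve longer and longer prefixes
  of \<open>C\<close>, each step applying (1) to the prefix already solved. To follow a replacement
  through a derivation, both sequent calculi are recast as one natural deduction system
  \<open>nd\<close> with a fixed set of hypotheses. Only two kinds of step change there: a
  constructor that builds the replaced message becomes an axiom for the common name, and a
  destructor applied to that message is repaired by deriving its components directly. As to
  computability, primitive recursion runs over numbers only; structural recursions on lists and
  messages are simulated by iterating a step on stacks, with a number of rounds obtained from the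
  code of the argument.\<close>

section \<open>Computable functions between encoded types\<close>

class encodable =
  fixes encode :: "'a \<Rightarrow> nat"
  assumes inj_encode: "inj encode"

lemma encode_eq_iff [simp]: "encode x = encode y \<longleftrightarrow> x = y"
  by (meson inj_encode injD)

instantiation nat :: encodable
begin
definition encode_nat :: "nat \<Rightarrow> nat" where [simp]: "encode_nat n = n"
instance by standard (simp add: inj_def)
end

instantiation bool :: encodable
begin
definition encode_bool :: "bool \<Rightarrow> nat" where "encode_bool b = (if b then 1 else 0)"
instance by standard (simp add: inj_def encode_bool_def)
end

instantiation prod :: (encodable, encodable) encodable
begin
definition encode_prod :: "'a \<times> 'b \<Rightarrow> nat" where
  "encode_prod p = prod_encode (encode (fst p), encode (snd p))"
instance by standard (auto simp: inj_def encode_prod_def)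
end

instantiation list :: (encodable) encodable
begin
definition encode_list :: "'a list \<Rightarrow> nat" where
  "encode_list xs = list_encode (map encode xs)"
instance by standard (simp add: inj_def encode_list_def list_encode_eq inj_map_eq_map[OF inj_encode])
end

instantiation msg :: encodable
begin
definition encode_msg :: "msg \<Rightarrow> nat" where "encode_msg = msg_code"
instance by standard (simp add: encode_msg_def inj_msg_code)
end

text \<open>Programs are constrained on codes only; on other numbers they may return anything or
  diverge.\<close>

definition computable :: "('a::encodable \<Rightarrow> 'b::encodable) \<Rightarrow> bool" where
  "computable f \<longleftrightarrow> (\<exists>r. \<forall>x. run r [encode x] = Some (encode (f x)))"

lemma computableI: "(\<And>x. run r [encode x] = Some (encode (f x))) \<Longrightarrow> computable f"
  unfolding computable_def by blast

lemma computableE: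
  assumes "computable f"
  obtains r where "\<And>x. run r [encode x] = Some (encode (f x))"
  using assms unfolding computable_def by blast

text \<open>No decoding is involved, so that a function may be traded for one with other types that
  has the same effect on codes.\<close>

lemma computable_transfer:
  assumes "computable g" "\<And>x. encode (h x) = encode x" "\<And>x. encode (f x) = encode (g (h x))"
  shows "computable f"
  using assms unfolding computable_def by metis

section \<open>Primitive recursive arithmetic and Cantor pairing\<close>

definition "rf_add = PrimRec (Proj 0) (Comp Succ [Proj 1])"
definition "rf_pred = PrimRec Zero (Proj 0)"
definition "rf_sub = Comp (PrimRec (Proj 0) (Comp rf_pred [Proj 1])) [Proj 1, Proj 0]"
definition "rf_triangle = PrimRec Zero (Comp Succ [Comp rf_add [Proj 0, Proj 1]])"
definition "rf_pair = Comp rf_add [Comp rf_triangle [rf_add], Proj 0]"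
definition "rf_if = PrimRec (Proj 1) (Proj 2)"
text \<open>The greatest \<open>s\<close> with \<open>triangle s \<le> n\<close>, which is
  \<open>x + y\<close> when \<open>n = prod_encode (x, y)\<close>. From \<open>n\<close> to
  \<open>n + 1\<close> it grows exactly when \<open>triangle (s + 1) < n + 2\<close>; the truncated
  difference tests this.\<close>

definition "rf_diagonal = PrimRec Zero
  (Comp rf_if [Comp rf_sub [Comp Succ [Comp Succ [Proj 0]], Comp rf_triangle [Comp Succ [Proj 1]]],
    Comp Succ [Proj 1], Proj 1])"
definition "rf_fst = Comp rf_sub [Proj 0, Comp rf_triangle [rf_diagonal]]"
definition "rf_snd = Comp rf_sub [rf_diagonal, rf_fst]"

primrec rf_const :: "nat \<Rightarrow> recf" where
  "rf_const 0 = Zero"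
| "rf_const (Suc n) = Comp Succ [rf_const n]"

lemma run_const [simp]: "run (rf_const n) xs = Some n"
  by (induction n) simp_all

lemma run_add [simp]: "run rf_add [x, y] = Some (x + y)"
  unfolding rf_add_def by (induction x) simp_all

lemma run_pred [simp]: "run rf_pred [x] = Some (x - 1)"
  unfolding rf_pred_def by (cases x) (simp_all, induct_tac nat, simp_all)

lemma run_sub [simp]: "run rf_sub [x, y] = Some (x - y)"
proof -
  have "run (PrimRec (Proj 0) (Comp rf_pred [Proj 1])) [y, x] = Some (x - y)"
    by (induction y) simp_all
  then show ?thesis unfolding rf_sub_def by simp
qed

lemma run_triangle [simp]: "run rf_triangle [x] = Some (triangle x)"
  unfolding rf_triangle_def by (induction x) (simp_all add: add.commute)

lemma run_pair [simp]: "run rf_pair [x, y] = Some (prod_encode (x, y))"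
  unfolding rf_pair_def by (simp add: prod_encode_def)

lemma run_if [simp]: "run rf_if [c, x, y] = Some (if c = 0 then y else x)"
proof -
  have "run (PrimRec (Proj 1) (Proj 2)) [c, x, y] = Some (if c = 0 then y else x)"
    by (induction c) simp_all
  then show ?thesis unfolding rf_if_def .
qed

lemma run_diagonal:
  "\<exists>s. run rf_diagonal [n] = Some s \<and> triangle s \<le> n \<and> n < triangle (Suc s)"
  unfolding rf_diagonal_def
proof (induction n)
  case (Suc n)
  then obtain s where "triangle s \<le> n" "n < triangle (Suc s)"
    and "run (PrimRec Zero (Comp rf_if
      [Comp rf_sub [Comp Succ [Comp Succ [Proj 0]], Comp rf_triangle [Comp Succ [Proj 1]]],
       Comp Succ [Proj 1], Proj 1])) [n] = Some s"
    by blast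
  then show ?case by auto
qed simp

lemma triangle_unique:
  assumes "triangle s \<le> n" "n < triangle (Suc s)" "triangle t \<le> n" "n < triangle (Suc t)"
  shows "s = t"
proof -
  have mono: "triangle a \<le> triangle b" if "a \<le> b" for a b
    using that by (induction rule: dec_induct) simp_all
  show ?thesis
    using assms mono[of "Suc s" t] mono[of "Suc t" s] by (meson leD le_less_trans not_less_eq_eq nat_le_linear antisym)
qed

lemma run_diagonal_prod_encode [simp]: "run rf_diagonal [prod_encode (x, y)] = Some (x + y)"
proof -
  have "triangle (x + y) \<le> prod_encode (x, y)" "prod_encode (x, y) < triangle (Suc (x + y))"
    by (simp_all add: prod_encode_def)
  then show ?thesis using run_diagonal triangle_unique by metis
qed

lemma run_fst [simp]: "run rf_fst [prod_encode (x, y)] = Some x"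
  and run_snd [simp]: "run rf_snd [prod_encode (x, y)] = Some y"
  unfolding rf_snd_def rf_fst_def by (simp_all, simp_all add: prod_encode_def)

section \<open>Closure properties of computability\<close>

named_theorems computable_intros

lemma computable_id [computable_intros]: "computable (\<lambda>x. x)"
  by (rule computableI[of "Proj 0"]) simp

lemma computable_const [computable_intros]: "computable (\<lambda>x. c)"
  by (rule computableI[of "rf_const (encode c)"]) simp

lemma computable_comp:
  assumes "computable f" "computable g"
  shows "computable (\<lambda>x. f (g x))"
proof -
  obtain r s where "\<And>x. run r [encode x] = Some (encode (f x))"
    "\<And>x. run s [encode x] = Some (encode (g x))"
    using assms by (meson computableE)
  then show ?thesis by (intro computableI[of "Comp r [s]"]) simp
qed

lemma computable_Pair [computable_intros]:
  assumes "computable f" "computable g"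
  shows "computable (\<lambda>x. (f x, g x))"
proof -
  obtain r s where "\<And>x. run r [encode x] = Some (encode (f x))"
    "\<And>x. run s [encode x] = Some (encode (g x))"
    using assms by (meson computableE)
  then show ?thesis by (intro computableI[of "Comp rf_pair [r, s]"]) (simp add: encode_prod_def)
qed

lemma computable_fst [computable_intros]: "computable f \<Longrightarrow> computable (\<lambda>x. fst (f x))"
  by (rule computable_comp[of fst], rule computableI[of rf_fst]) (simp_all add: encode_prod_def)

lemma computable_snd [computable_intros]: "computable f \<Longrightarrow> computable (\<lambda>x. snd (f x))"
  by (rule computable_comp[of snd], rule computableI[of rf_snd]) (simp_all add: encode_prod_def)

lemma computable_binary:
  assumes "\<And>x y. run r [encode x, encode y] = Some (encode (h x y))"
    and "computable f" "computable g"
  shows "computable (\<lambda>x. h (f x) (g x))"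
proof -
  obtain s t where "\<And>x. run s [encode x] = Some (encode (f x))"
    "\<And>x. run t [encode x] = Some (encode (g x))"
    using assms(2,3) by (meson computableE)
  then show ?thesis by (intro computableI[of "Comp r [s, t]"]) (simp add: assms(1))
qed

lemma computable_add [computable_intros]:
  fixes f g :: "'a::encodable \<Rightarrow> nat"
  shows "computable f \<Longrightarrow> computable g \<Longrightarrow> computable (\<lambda>x. f x + g x)"
  by (rule computable_binary[of rf_add]) simp_all

lemma computable_diff [computable_intros]:
  fixes f g :: "'a::encodable \<Rightarrow> nat"
  shows "computable f \<Longrightarrow> computable g \<Longrightarrow> computable (\<lambda>x. f x - g x)"
  by (rule computable_binary[of rf_sub]) simp_all

lemma computable_Suc [computable_intros]: "computable f \<Longrightarrow> computable (\<lambda>x. Suc (f x))"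
  by (rule computable_comp[of Suc], rule computableI[of Succ]) simp_all

lemma computable_encode [computable_intros]: "computable f \<Longrightarrow> computable (\<lambda>x. encode (f x))"
  by (rule computable_comp[of encode], rule computableI[of "Proj 0"]) simp_all

text \<open>Composition is strict, so both branches are run; this is harmless because both are
  total.\<close>

lemma computable_if [computable_intros]:
  assumes "computable c" "computable f" "computable g"
  shows "computable (\<lambda>x. if c x then f x else g x)"
proof -
  obtain r s t where "\<And>x. run r [encode x] = Some (encode (c x))"
    "\<And>x. run s [encode x] = Some (encode (f x))" "\<And>x. run t [encode x] = Some (encode (g x))"
    using assms by (meson computableE)
  then show ?thesis
    by (intro computableI[of "Comp rf_if [r, s, t]"]) (simp add: encode_bool_def)
qed

lemma computable_eq [computable_intros]:
  "computable f \<Longrightarrow> computable g \<Longrightarrow> computable (\<lambda>x. f x = g x)"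
proof (rule computable_binary[where h = "(=)"])
  fix x y :: 'b
  show "run (Comp rf_if [Comp rf_add [Comp rf_sub [Proj 0, Proj 1], Comp rf_sub [Proj 1, Proj 0]],
      Zero, rf_const 1]) [encode x, encode y] = Some (encode (x = y))"
    using encode_eq_iff[of x y] by (auto simp: encode_bool_def simp del: encode_eq_iff)
qed

lemma computable_not [computable_intros]:
  assumes "computable f" shows "computable (\<lambda>x. \<not> f x)"
proof -
  have eq: "(\<not> p) = (if p then False else True)" for p by simp
  show ?thesis unfolding eq by (intro computable_intros assms)
qed

lemma computable_conj [computable_intros]:
  assumes "computable f" "computable g" shows "computable (\<lambda>x. f x \<and> g x)"
proof -
  have eq: "(p \<and> q) = (if p then q else False)" for p q by simp
  show ?thesis unfolding eq by (intro computable_intros assms)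
qed

lemma computable_disj [computable_intros]:
  assumes "computable f" "computable g" shows "computable (\<lambda>x. f x \<or> g x)"
proof -
  have eq: "(p \<or> q) = (if p then True else q)" for p q by simp
  show ?thesis unfolding eq by (intro computable_intros assms)
qed

text \<open>\<open>computable\<close> speaks of unary functions, so a step with several arguments is
  taken on nested pairs. The ambient parameter comes first, since the step may depend on it.\<close>

lemma computable_rec_nat:
  assumes "computable n" "computable b"
    and "computable (\<lambda>w. s (fst w) (fst (snd w)) (snd (snd w)))"
  shows "computable (\<lambda>x. rec_nat (b x) (s x) (n x))"
proof -
  obtain rn rb rs where r: "\<And>x. run rn [encode x] = Some (encode (n x))"
    "\<And>x. run rb [encode x] = Some (encode (b x))"
    "\<And>w. run rs [encode w] = Some (encode (s (fst w) (fst (snd w)) (snd (snd w))))"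
    using assms by (meson computableE)
  have s: "run rs [prod_encode (encode x, prod_encode (m, encode v))] = Some (encode (s x m v))"
    for x m v
    using r(3)[of "(x, m, v)"] by (simp add: encode_prod_def)
  have "run (PrimRec rb (Comp rs [Comp rf_pair [Proj 2, Comp rf_pair [Proj 0, Proj 1]]]))
      [k, encode x] = Some (encode (rec_nat (b x) (s x) k))" for k x
    by (induction k) (simp_all add: r s)
  then show ?thesis
    by (intro computableI[of "Comp (PrimRec rb
      (Comp rs [Comp rf_pair [Proj 2, Comp rf_pair [Proj 0, Proj 1]]])) [rn, Proj 0]"]) (simp add: r)
qed

lemma computable_funpow [computable_intros]:
  fixes f :: "'a::encodable \<Rightarrow> 'b::encodable \<Rightarrow> 'b"
  assumes "computable n" "computable b" "computable (\<lambda>w. f (fst w) (snd w))"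
  shows "computable (\<lambda>x. (f x ^^ n x) (b x))"
proof -
  have "(f x ^^ k) y = rec_nat y (\<lambda>_. f x) k" for x k y
    by (induction k) simp_all
  moreover have "computable (\<lambda>w. f (fst w) (snd (snd w)))"
    using computable_comp[OF assms(3), of "\<lambda>w. (fst w, snd (snd w))"]
    by (simp add: computable_intros)
  ultimately show ?thesis
    using computable_rec_nat[OF assms(1,2), of "\<lambda>x m. f x"] by simp
qed

section \<open>List operations\<close>

lemma computable_Cons [computable_intros]:
  assumes "computable f" "computable g"
  shows "computable (\<lambda>x. f x # g x)"
proof -
  have "computable (\<lambda>x. Suc (encode (f x, g x)))"
    by (intro computable_intros assms)
  then show ?thesis
    by (rule computable_transfer[where h = "\<lambda>x. x"])
      (simp_all add: encode_list_def encode_prod_def)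
qed

text \<open>By strictness the projections are run for the empty list too, and there on the number 0;
  as a pair code it has a known result.\<close>

lemma zero_code: "prod_encode (0, 0) = 0"
  by (simp add: prod_encode_def)

lemma computable_hd [computable_intros]:
  assumes "computable f" shows "computable (\<lambda>x. hd (f x))"
proof (rule computable_comp[OF _ assms], rule computableI)
  \<comment> \<open>\<open>hd []\<close> is unspecified but fixed, so its code can be built into the
    program.\<close>
  show "run (Comp rf_if [Proj 0, Comp rf_fst [Comp rf_pred [Comp rf_if [Proj 0, Proj 0, rf_const 1]]],
      rf_const (encode (hd [] :: 'b))]) [encode xs] = Some (encode (hd xs))" for xs :: "'b list"
    using run_fst[of 0 0]
    by (cases xs) (simp_all add: encode_list_def zero_code)
qed

lemma computable_tl [computable_intros]:
  assumes "computable f" shows "computable (\<lambda>x. tl (f x))"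
proof (rule computable_comp[OF _ assms], rule computableI)
  show "run (Comp rf_snd [Comp rf_pred [Comp rf_if [Proj 0, Proj 0, rf_const 1]]])
      [encode xs] = Some (encode (tl xs))" for xs :: "'b list"
    using run_snd[of 0 0]
    by (cases xs) (simp_all add: encode_list_def zero_code)
qed

text \<open>Bounds the rounds needed to traverse a list by a number that is at hand, its
  code.\<close>

lemma length_le_encode: "length xs \<le> encode xs"
proof (induction xs)
  case (Cons x xs)
  then show ?case
    using le_prod_encode_2[of "list_encode (map encode xs)" "encode x"]
    by (simp add: encode_list_def)
qed simp

lemma computable_fold:
  assumes f: "computable (\<lambda>w. f (fst w) (fst (snd w)) (snd (snd w)))"
    and l: "computable l" and b: "computable b"
  shows "computable (\<lambda>z. fold (f z) (l z) (b z))"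
proof -
  define s where
    "s z p = (if fst p = [] then p else (tl (fst p), f z (hd (fst p)) (snd p)))" for z p
  have "(s z ^^ length xs) (xs, y) = ([], fold (f z) xs y)" for z xs y
    by (induction xs arbitrary: y) (simp_all add: s_def funpow_swap1)
  \<comment> \<open>The step is idle on the empty list, so surplus rounds do no harm.\<close>
  moreover have "(s z ^^ n) ([], y) = ([], y)" for z n y
    by (induction n) (simp_all add: s_def)
  ultimately have "(s z ^^ (n + length xs)) (xs, y) = ([], fold (f z) xs y)" for z xs y n
    by (simp add: funpow_add)
  then have eq: "fold (f z) (l z) (b z) = snd ((s z ^^ encode (l z)) (l z, b z))" for z
    using le_add_diff_inverse2[OF length_le_encode[of "l z"]] by (metis snd_conv)
  have "computable (\<lambda>w. f (fst w) (hd (fst (snd w))) (snd (snd w)))"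
    using computable_comp[OF f, of "\<lambda>w. (fst w, hd (fst (snd w)), snd (snd w))"]
    by (simp add: computable_intros)
  then show ?thesis
    unfolding eq s_def by (intro computable_intros l b)
qed

lemma computable_foldr [computable_intros]:
  assumes f: "computable (\<lambda>w. f (fst w) (fst (snd w)) (snd (snd w)))"
    and l: "computable l" and b: "computable b"
  shows "computable (\<lambda>z. foldr (f z) (l z) (b z))"
proof -
  have rev: "rev xs = fold Cons xs []" for xs :: "'b list"
    using fold_Cons_rev[of xs] by simp
  have "computable (\<lambda>z. rev (l z))"
    unfolding rev by (intro computable_fold computable_intros l)
  then show ?thesis
    unfolding foldr_conv_fold by (intro computable_fold f b)
qed

lemma computable_append [computable_intros]:
  assumes "computable f" "computable g"
  shows "computable (\<lambda>z. f z @ g z)"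
proof -
  have eq: "xs @ ys = foldr Cons xs ys" for xs ys :: "'b list"
    by (induction xs) simp_all
  show ?thesis unfolding eq by (intro computable_intros assms)
qed

lemma computable_length [computable_intros]:
  assumes "computable f" shows "computable (\<lambda>z. length (f z))"
proof -
  have eq: "length xs = foldr (\<lambda>_. Suc) xs 0" for xs :: "'b list"
    by (induction xs) simp_all
  show ?thesis unfolding eq by (intro computable_intros assms)
qed

lemma computable_map [computable_intros]:
  assumes "computable (\<lambda>w. f (fst w) (snd w))" "computable l"
  shows "computable (\<lambda>z. map (f z) (l z))"
proof -
  have eq: "map g xs = foldr (\<lambda>x ys. g x # ys) xs []" for g :: "'b \<Rightarrow> 'c" and xs
    by (induction xs) simp_all
  have "computable (\<lambda>w. f (fst w) (fst (snd w)))"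
    using computable_comp[OF assms(1), of "\<lambda>w. (fst w, fst (snd w))"]
    by (simp add: computable_intros)
  then show ?thesis unfolding eq by (intro computable_intros assms(2))
qed

lemma computable_concat [computable_intros]:
  assumes "computable l" shows "computable (\<lambda>z. concat (l z))"
  unfolding concat_conv_foldr by (intro computable_intros assms)

lemma computable_filter [computable_intros]:
  assumes "computable (\<lambda>w. P (fst w) (snd w))" "computable l"
  shows "computable (\<lambda>z. filter (P z) (l z))"
proof -
  have eq: "filter Q xs = concat (map (\<lambda>x. if Q x then [x] else []) xs)" for Q and xs :: "'b list"
    by (induction xs) simp_all
  show ?thesis unfolding eq by (intro computable_intros assms)
qed

lemma computable_Bex [computable_intros]:
  assumes "computable (\<lambda>w. P (fst w) (snd w))" "computable l"
  shows "computable (\<lambda>z. \<exists>x\<in>set (l z). P z x)"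
proof -
  have eq: "(\<exists>x\<in>set xs. Q x) = (filter Q xs \<noteq> [])" for Q and xs :: "'b list"
    by (auto simp: filter_empty_conv)
  show ?thesis unfolding eq by (intro computable_intros assms)
qed

lemma computable_Ball [computable_intros]:
  assumes "computable (\<lambda>w. P (fst w) (snd w))" "computable l"
  shows "computable (\<lambda>z. \<forall>x\<in>set (l z). P z x)"
proof -
  have eq: "(\<forall>x\<in>set xs. Q x) = (filter (\<lambda>x. \<not> Q x) xs = [])" for Q and xs :: "'b list"
    by (auto simp: filter_empty_conv)
  show ?thesis unfolding eq by (intro computable_intros assms)
qed

lemma computable_member [computable_intros]:
  assumes "computable f" "computable l"
  shows "computable (\<lambda>z. f z \<in> set (l z))"
proof -
  have eq: "x \<in> set xs \<longleftrightarrow> (\<exists>y\<in>set xs. x = y)" for x :: 'b and xs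
    by auto
  have "computable (\<lambda>w. f (fst w))"
    by (rule computable_comp[OF assms(1)]) (intro computable_intros)
  then show ?thesis unfolding eq by (intro computable_intros assms(2))
qed

section \<open>The elements of an encoded set\<close>

lemma computable_mod_2 [computable_intros]:
  assumes "computable f" shows "computable (\<lambda>x. f x mod (2::nat))"
proof -
  have eq: "n mod 2 = rec_nat 0 (\<lambda>_ v. 1 - v) n" for n :: nat
  proof (induction n)
    case (Suc n)
    have "Suc n mod 2 = 1 - n mod 2" by presburger
    with Suc show ?case by simp
  qed simp
  show ?thesis unfolding eq by (intro computable_rec_nat computable_intros assms)
qed

lemma computable_div_2 [computable_intros]:
  assumes "computable f" shows "computable (\<lambda>x. f x div (2::nat))"
proof -
  have eq: "n div 2 = rec_nat 0 (\<lambda>m v. v + m mod 2) n" for n :: nat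
    by (induction n) (simp_all, presburger)
  show ?thesis unfolding eq by (intro computable_rec_nat computable_intros assms)
qed

text \<open>A computable counterpart of \<open>set_decode\<close>. Positions below \<open>n\<close>
  suffice because \<open>n < 2 ^ n\<close>.\<close>

definition bits :: "nat \<Rightarrow> nat list" where
  "bits n = rec_nat [] (\<lambda>i l. if ((\<lambda>q. q div 2) ^^ i) n mod 2 = 1 then i # l else l) n"

lemma set_bits: "set (bits n) = set_decode n"
proof -
  have pow: "((\<lambda>q. q div 2) ^^ i) n = n div 2 ^ i" for i
    by (induction i) (simp_all flip: div_mult2_eq add: mult.commute)
  have bits_eq: "bits n = rec_nat [] (\<lambda>i l. if odd (n div 2 ^ i) then i # l else l) n"
    unfolding bits_def pow odd_iff_mod_2_eq_one ..
  have "set (rec_nat [] (\<lambda>i l. if odd (n div 2 ^ i) then i # l else l) k) =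
      {i. i < k \<and> odd (n div 2 ^ i)}" for k
    by (induction k) (auto simp: less_Suc_eq)
  moreover have "i < n" if "odd (n div 2 ^ i)" for i
  proof (rule ccontr)
    assume "\<not> i < n"
    then have "n < 2 ^ i" using less_exp[of i] by linarith
    with that show False by simp
  qed
  ultimately show ?thesis unfolding bits_eq set_decode_def by auto
qed

lemma computable_bits [computable_intros]:
  assumes "computable f" shows "computable (\<lambda>x. bits (f x))"
  by (rule computable_comp[OF _ assms]) (unfold bits_def, intro computable_rec_nat computable_intros)

section \<open>Natural deduction\<close>

text \<open>The flag tells whether the decomposition rules are allowed: it is \<open>True\<close> for proper and
  \<open>False\<close> for right constraints.\<close>

inductive nd :: "bool \<Rightarrow> msg set \<Rightarrow> msg \<Rightarrow> bool" for d \<Gamma> where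
  ax: "M \<in> \<Gamma> \<Longrightarrow> nd d \<Gamma> M"
| fst: "d \<Longrightarrow> nd d \<Gamma> (Pair M N) \<Longrightarrow> nd d \<Gamma> M"
| snd: "d \<Longrightarrow> nd d \<Gamma> (Pair M N) \<Longrightarrow> nd d \<Gamma> N"
| dec: "d \<Longrightarrow> nd d \<Gamma> (Enc M K) \<Longrightarrow> nd d \<Gamma> K \<Longrightarrow> nd d \<Gamma> M"
| pair: "nd d \<Gamma> M \<Longrightarrow> nd d \<Gamma> N \<Longrightarrow> nd d \<Gamma> (Pair M N)"
| enc: "nd d \<Gamma> M \<Longrightarrow> nd d \<Gamma> K \<Longrightarrow> nd d \<Gamma> (Enc M K)"

text \<open>Hypotheses enter a derivation only through \<open>ax\<close> and never change, so
  derivations of them can be plugged in there. The left rules of the sequent calculus are translated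
  this way.\<close>

lemma nd_cut: "nd d \<Delta> M \<Longrightarrow> (\<And>N. N \<in> \<Delta> \<Longrightarrow> nd d \<Gamma> N) \<Longrightarrow> nd d \<Gamma> M"
  by (induction rule: nd.induct) (auto intro: nd.intros)

lemma nd_True: "nd d \<Gamma> M \<Longrightarrow> nd True \<Gamma> M"
  by (induction rule: nd.induct) (auto intro: nd.intros)

lemma derivable_weaken: "\<Gamma> \<turnstile> M \<Longrightarrow> \<Gamma> \<subseteq> \<Delta> \<Longrightarrow> \<Delta> \<turnstile> M"
proof (induction arbitrary: \<Delta> rule: derivable.induct)
  case (pL \<Gamma> M N T)
  have "\<Delta> \<union> {Pair M N} \<turnstile> T"
    by (rule derivable.pL[OF pL.IH]) (use pL.prems in auto)
  with pL.prems show ?case by (simp add: insert_absorb)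
next
  case (eL \<Gamma> M K N)
  have "\<Delta> \<union> {Enc M K} \<turnstile> N"
    by (rule derivable.eL[OF eL.IH]) (use eL.prems in auto)
  with eL.prems show ?case by (simp add: insert_absorb)
qed (auto intro: derivable.id derivable.pR derivable.eR)

lemma derivable_absorb:
  "Pair M N \<in> \<Gamma> \<Longrightarrow> insert M (insert N \<Gamma>) \<turnstile> T \<Longrightarrow> \<Gamma> \<turnstile> T"
  "Enc M K \<in> \<Gamma> \<Longrightarrow> \<Gamma> \<turnstile> K \<Longrightarrow> insert M (insert K \<Gamma>) \<turnstile> T \<Longrightarrow> \<Gamma> \<turnstile> T"
  using derivable.pL[of \<Gamma> M N T] derivable.eL[of \<Gamma> M K T]
  by (simp_all add: insert_absorb insert_commute)

text \<open>Admissibility of the two projections without a general cut: a final left rule is moved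
  below the projection, \<open>pR\<close> has the components as premises, and an axiom is taken
  apart by \<open>pL\<close>.\<close>

lemma derivable_Pair_components:
  "\<Gamma> \<turnstile> P \<Longrightarrow> P = Pair M N \<Longrightarrow> \<Gamma> \<turnstile> M \<and> \<Gamma> \<turnstile> N"
proof (induction rule: derivable.induct)
  case (id P \<Gamma>)
  then show ?case by (auto intro: derivable_absorb(1) derivable.id)
next
  case (pL \<Gamma> M' N' T)
  then show ?case using derivable.pL[of \<Gamma> M' N'] by blast
next
  case (eL \<Gamma> M' K T)
  then show ?case using derivable.eL[of \<Gamma> M' K] by blast
qed auto

lemma derivable_decrypt:
  "\<Gamma> \<turnstile> P \<Longrightarrow> P = Enc M K \<Longrightarrow> \<Gamma> \<turnstile> K \<Longrightarrow> \<Gamma> \<turnstile> M"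
proof (induction rule: derivable.induct)
  case (id P \<Gamma>)
  then show ?case by (auto intro: derivable_absorb(2) derivable.id)
next
  case (pL \<Gamma> M' N T)
  then have "\<Gamma> \<union> {Pair M' N, M', N} \<turnstile> K" by (auto elim: derivable_weaken)
  with pL show ?case using derivable.pL[of \<Gamma> M' N] by blast
next
  case (eL \<Gamma> M' K' N)
  then have "\<Gamma> \<union> {Enc M' K', M', K'} \<turnstile> K" by (auto elim: derivable_weaken)
  with eL show ?case using derivable.eL[of \<Gamma> M' K'] by blast
qed auto

lemma derivable_iff_nd: "\<Gamma> \<turnstile> M \<longleftrightarrow> nd True \<Gamma> M"
proof
  show "nd True \<Gamma> M" if "\<Gamma> \<turnstile> M"
    using that
  proof (induction rule: derivable.induct)
    case (pL \<Gamma> M N T)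
    show ?case by (rule nd_cut[OF pL.IH]) (auto intro: nd.intros)
  next
    case (eL \<Gamma> M K N)
    show ?case by (rule nd_cut[OF eL.IH(2)]) (use eL.IH(1) in \<open>auto intro: nd.intros\<close>)
  qed (auto intro: nd.intros)
  show "\<Gamma> \<turnstile> M" if "nd True \<Gamma> M"
    using that
    by (induction rule: nd.induct)
      (auto intro: derivable.id derivable.pR derivable.eR derivable_decrypt
        dest: derivable_Pair_components)
qed

lemma derivable_right_iff_nd: "\<Gamma> \<turnstile>\<^sub>R M \<longleftrightarrow> nd False \<Gamma> M"
proof
  show "nd False \<Gamma> M" if "\<Gamma> \<turnstile>\<^sub>R M"
    using that by (induction rule: derivable_right.induct) (auto intro: nd.intros)
  show "\<Gamma> \<turnstile>\<^sub>R M" if "nd False \<Gamma> M"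
    using that by (induction rule: nd.induct) (auto intro: derivable_right.intros)
qed

primrec is_proper :: "constr \<Rightarrow> bool" where
  "is_proper (Proper S M) = True"
| "is_proper (Right S M) = False"

lemma solves_constr_iff_nd:
  "solves_constr \<theta> c \<longleftrightarrow> nd (is_proper c) (subst \<theta> ` lhs c) (subst \<theta> (rhs c))"
  by (cases c) (simp_all add: derivable_iff_nd derivable_right_iff_nd)

section \<open>Locality\<close>

definition closed_under_components :: "msg set \<Rightarrow> bool" where
  "closed_under_components U \<longleftrightarrow>
     (\<forall>M N. Pair M N \<in> U \<or> Enc M N \<in> U \<longrightarrow> M \<in> U \<and> N \<in> U)"

text \<open>The partner \<open>w\<close> ranges over \<open>U\<close> so that the algorithm searches
  a finite list; for \<open>X \<subseteq> U\<close> with \<open>U\<close> closed under components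
  this is no restriction.\<close>

definition nd_step :: "bool \<Rightarrow> msg set \<Rightarrow> msg set \<Rightarrow> msg set \<Rightarrow> msg set" where
  "nd_step d \<Gamma> U X = {M\<in>U. M \<in> \<Gamma> \<or> (\<exists>v\<in>X. \<exists>w\<in>X. M = Pair v w \<or> M = Enc v w) \<or>
     d \<and> (\<exists>v\<in>X. \<exists>w\<in>U. v = Pair M w \<or> v = Pair w M \<or> v = Enc M w \<and> w \<in> X)}"

lemma nd_step_sound: "(\<And>M. M \<in> X \<Longrightarrow> nd d \<Gamma> M) \<Longrightarrow> M \<in> nd_step d \<Gamma> U X \<Longrightarrow> nd d \<Gamma> M"
  unfolding nd_step_def by (auto intro: nd.intros)

text \<open>Derivations are not normalised. Instead, every derivable message is composed from
  \<open>X\<close> by constructor rules alone: a destructor either undoes the last of these or acts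
  on an element of \<open>X\<close>, whose components lie in \<open>U\<close> and are caught by the
  fixpoint. Composition inside \<open>U\<close> does not leave \<open>X\<close>.\<close>

lemma nd_step_fixpoint_complete:
  assumes fix_eq: "nd_step d \<Gamma> U X = X" and sub: "\<Gamma> \<subseteq> U"
    and U: "closed_under_components U" and M: "nd d \<Gamma> M" "M \<in> U"
  shows "M \<in> X"
proof -
  have XU: "X \<subseteq> U" and G: "\<Gamma> \<subseteq> X"
    using fix_eq sub unfolding nd_step_def by auto
  have comp: "Pair v w \<in> U \<Longrightarrow> Pair v w \<in> X" "Enc v w \<in> U \<Longrightarrow> Enc v w \<in> X"
    if "v \<in> X" "w \<in> X" for v w
    using that by (subst fix_eq[symmetric], simp add: nd_step_def)+
  have synth: "k \<in> X" if "nd False X k" "k \<in> U" for k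
    using that
  proof (induction rule: nd.induct)
    case (pair M N)
    with U have "M \<in> U" "N \<in> U" unfolding closed_under_components_def by blast+
    with pair comp(1) show ?case by blast
  next
    case (enc M K)
    with U have "M \<in> U" "K \<in> U" unfolding closed_under_components_def by blast+
    with enc comp(2) show ?case by blast
  qed auto
  have closed: "v \<in> U" "w \<in> U" if "Pair v w \<in> X \<or> Enc v w \<in> X" for v w
    using that XU U unfolding closed_under_components_def by blast+
  have split: "v \<in> X" "w \<in> X" if "Pair v w \<in> X" d for v w
    using that closed[of v w] by (subst fix_eq[symmetric], auto simp: nd_step_def)+
  have decr: "v \<in> X" if "Enc v w \<in> X" "w \<in> X" d for v w
    using that closed[of v w] by (subst fix_eq[symmetric], auto simp: nd_step_def)
  have "nd False X M"
    using M(1)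
  proof (induction rule: nd.induct)
    case (fst M N)
    from fst.IH show ?case by cases (auto dest: split(1)[OF _ fst.hyps(1)] intro: nd.ax)
  next
    case (snd M N)
    from snd.IH show ?case by cases (auto dest: split(2)[OF _ snd.hyps(1)] intro: nd.ax)
  next
    case (dec M K)
    from dec.IH(1) show ?case
    proof cases
      case ax
      \<comment> \<open>The key of a message in \<open>X\<close> belongs to \<open>U\<close>; being
        composed from \<open>X\<close>, it lies in \<open>X\<close> itself, as
        \<open>nd_step\<close> demands.\<close>
      then have "K \<in> X" using closed[of M K] dec.IH(2) synth by blast
      with ax dec.hyps(1) decr show ?thesis by (blast intro: nd.ax)
    qed auto
  qed (use G in \<open>auto intro: nd.intros\<close>)
  with synth M(2) show ?thesis by blast
qed

text \<open>Iterates growing for \<open>n + 1\<close> rounds would have more than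
  \<open>card U\<close> elements. A larger \<open>n\<close> is allowed because the algorithm uses
  the length of a list with possible repetitions.\<close>

lemma nd_local:
  assumes fin: "finite U" and sub: "\<Gamma> \<subseteq> U" and U: "closed_under_components U" and M: "M \<in> U"
    and n: "card U \<le> n"
  shows "M \<in> (nd_step d \<Gamma> U ^^ n) {} \<longleftrightarrow> nd d \<Gamma> M"
proof
  let ?F = "nd_step d \<Gamma> U"
  have "\<forall>M\<in>(?F ^^ k) {}. nd d \<Gamma> M" for k
    by (induction k) (auto intro: nd_step_sound)
  then show "nd d \<Gamma> M" if "M \<in> (?F ^^ n) {}"
    using that by blast
  have "mono ?F" unfolding mono_def nd_step_def by blast
  then have inc: "(?F ^^ i) {} \<subseteq> (?F ^^ j) {}" if "i \<le> j" for i j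
    using that by (simp add: funpow_decreasing mono_def funpow_mono2)
  have bound: "(?F ^^ i) {} \<subseteq> U" for i
    by (cases i) (auto simp: nd_step_def)
  have "\<exists>k\<le>n. (?F ^^ Suc k) {} = (?F ^^ k) {}"
  proof (rule ccontr)
    assume "\<not> ?thesis"
    then have strict: "(?F ^^ k) {} \<subset> (?F ^^ Suc k) {}" if "k \<le> n" for k
      using inc[of k "Suc k"] that by auto
    have "k \<le> card ((?F ^^ k) {})" if "k \<le> Suc n" for k
      using that
    proof (induction k)
      case (Suc k)
      have "card ((?F ^^ k) {}) < card ((?F ^^ Suc k) {})"
        using Suc.prems strict[of k] finite_subset[OF bound fin, of "Suc k"]
        by (intro psubset_card_mono) simp_all
      with Suc show ?case by simp
    qed simp
    from this[of "Suc n"] card_mono[OF fin bound, of "Suc n"] n show False by simp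
  qed
  then obtain k where k: "k \<le> n" "?F ((?F ^^ k) {}) = (?F ^^ k) {}" by auto
  show "M \<in> (?F ^^ n) {}" if "nd d \<Gamma> M"
    using nd_step_fixpoint_complete[OF k(2) sub U that M] inc[OF k(1)] by blast
qed

section \<open>Minimal solutions\<close>

text \<open>Listed in the order of a reversed preorder traversal, so that a stack machine can
  evaluate a message from the list of its subterms.\<close>

primrec subterms :: "msg \<Rightarrow> msg list" where
  "subterms (Name a) = [Name a]"
| "subterms (Var x) = [Var x]"
| "subterms (Pair M N) = subterms N @ subterms M @ [Pair M N]"
| "subterms (Enc M K) = subterms K @ subterms M @ [Enc M K]"

lemma subterms_refl [simp]: "M \<in> set (subterms M)"
  by (cases M) simp_all

lemma subterms_trans: "M \<in> set (subterms N) \<Longrightarrow> N \<in> set (subterms T) \<Longrightarrow> M \<in> set (subterms T)"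
  by (induction T) auto

lemma size_subterms: "M \<in> set (subterms N) \<Longrightarrow> size M \<le> size N"
  by (induction N) auto

lemma Var_subterms_iff [simp]: "Var x \<in> set (subterms M) \<longleftrightarrow> x \<in> vars M"
  by (induction M) auto

lemma subterms_subst:
  "t \<in> set (subterms (subst \<theta> M)) \<Longrightarrow>
    (\<exists>u\<in>set (subterms M). u \<notin> range Var \<and> t = subst \<theta> u) \<or> (\<exists>y\<in>vars M. t \<in> set (subterms (\<theta> y)))"
  by (induction M) auto

lemma subterms_subst_Var: "y \<in> vars M \<Longrightarrow> set (subterms (\<theta> y)) \<subseteq> set (subterms (subst \<theta> M))"
  by (induction M) auto

section \<open>Replacing a message by a name\<close>

primrec replace :: "msg \<Rightarrow> msg \<Rightarrow> msg \<Rightarrow> msg" where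
  "replace t s (Name a) = (if Name a = t then s else Name a)"
| "replace t s (Var x) = (if Var x = t then s else Var x)"
| "replace t s (Pair M N) = (if Pair M N = t then s else Pair (replace t s M) (replace t s N))"
| "replace t s (Enc M K) = (if Enc M K = t then s else Enc (replace t s M) (replace t s K))"

lemma replace_self [simp]: "replace t s t = s"
  by (cases t) simp_all

lemma replace_absent: "t \<notin> set (subterms M) \<Longrightarrow> replace t s M = M"
  by (induction M) auto

text \<open>A message does not occur in its own components, so what a destructor extracts from
  \<open>t\<close> is unaffected by the replacement.\<close>

lemma replace_component:
  assumes "t = Pair M N \<or> t = Enc M N"
  shows "replace t s M = M" "replace t s N = N"
  using assms by (auto intro!: replace_absent dest: size_subterms)

text \<open>Under the assumption, every occurrence of \<open>t\<close> in the instance lies inside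
  the value of a variable.\<close>

lemma subst_replace:
  assumes "\<And>u. u \<in> set (subterms M) \<Longrightarrow> u \<notin> range Var \<Longrightarrow> subst \<theta> u \<noteq> t"
  shows "subst (\<lambda>x. replace t s (\<theta> x)) M = replace t s (subst \<theta> M)"
  using assms
proof (induction M)
  case (Name a)
  then show ?case using Name[of "Name a"] by auto
next
  case (Pair M N)
  then show ?case using Pair.prems[of "Pair M N"] by auto
next
  case (Enc M K)
  then show ?case using Enc.prems[of "Enc M K"] by auto
qed simp

text \<open>Size would not drop when \<open>a\<close> is put for another name; since
  \<open>a\<close> alone weighs nothing, replacing any other message counts as progress.\<close>

primrec weight :: "nat \<Rightarrow> msg \<Rightarrow> nat" where
  "weight a (Name b) = (if b = a then 0 else 1)"
| "weight a (Var x) = 1"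
| "weight a (Pair M N) = Suc (weight a M + weight a N)"
| "weight a (Enc M K) = Suc (weight a M + weight a K)"

lemma weight_replace: "weight a (replace t (Name a) M) \<le> weight a M"
  by (induction M) auto

lemma weight_eq_0_iff: "weight a M = 0 \<longleftrightarrow> M = Name a"
  by (cases M) auto

lemma vars_replace: "vars s = {} \<Longrightarrow> vars (replace t s M) \<subseteq> vars M"
  by (induction M) auto

text \<open>Destructors only pass on what occurs in their premises. A message foreign to the
  hypotheses was therefore built by a constructor rule, whose premises derive its
  components.\<close>

lemma nd_composed:
  assumes "nd d \<Gamma> u" "t \<in> set (subterms u)" "\<And>m. m \<in> \<Gamma> \<Longrightarrow> t \<notin> set (subterms m)"
    and "t = Pair M N \<or> t = Enc M N"
  shows "nd d \<Gamma> M \<and> nd d \<Gamma> N"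
  using assms by (induction rule: nd.induct) auto

text \<open>A constructor step that yields \<open>t\<close> becomes the axiom for \<open>a\<close>;
  a destructor step applied to \<open>t\<close> is served by \<open>comp\<close>. Without
  destructors there is nothing to repair, whence the premise \<open>d\<close> in
  \<open>comp\<close>.\<close>

lemma nd_replace:
  assumes "nd d \<Gamma> u" and a: "Name a \<in> \<Gamma>"
    and comp: "\<And>M N. d \<Longrightarrow> t = Pair M N \<or> t = Enc M N \<Longrightarrow>
      nd d (replace t (Name a) ` \<Gamma>) M \<and> nd d (replace t (Name a) ` \<Gamma>) N"
  shows "nd d (replace t (Name a) ` \<Gamma>) (replace t (Name a) u)"
proof -
  let ?r = "replace t (Name a)"
  have "?r (Name a) = Name a" by simp
  with a have a': "nd d (?r ` \<Gamma>) (Name a)"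
    by (metis imageI nd.ax)
  from assms(1) show ?thesis
  proof (induction rule: nd.induct)
    case (fst M N)
    then show ?case
      using comp[of M N] replace_component[of t M N] by (cases "Pair M N = t") (auto intro: nd.fst)
  next
    case (snd M N)
    then show ?case
      using comp[of M N] replace_component[of t M N] by (cases "Pair M N = t") (auto intro: nd.snd)
  next
    case (dec M K)
    then show ?case
      using comp[of M K] replace_component[of t M K] by (cases "Enc M K = t") (auto intro: nd.dec)
  qed (use a' in \<open>auto intro: nd.intros\<close>)
qed

section \<open>Constraint systems and their solutions\<close>

definition constr_msgs :: "constr \<Rightarrow> msg set" where
  "constr_msgs c = insert (rhs c) (lhs c)"

definition system_subterms :: "constr list \<Rightarrow> msg set" where
  "system_subterms C = (\<Union>c\<in>set C. \<Union>m\<in>constr_msgs c. set (subterms m))"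

definition system_vars :: "constr list \<Rightarrow> nat set" where
  "system_vars C = (\<Union>c\<in>set C. vars_constr c)"

lemma vars_constr_eq: "vars_constr c = (\<Union>m\<in>constr_msgs c. vars m)"
  by (auto simp: vars_constr_def vars_set_def constr_msgs_def)

lemma system_vars_eq: "system_vars C = {x. Var x \<in> system_subterms C}"
  by (auto simp: system_vars_def system_subterms_def vars_constr_eq)

lemma subterms_system_subterms:
  "M \<in> set (subterms N) \<Longrightarrow> N \<in> system_subterms C \<Longrightarrow> M \<in> system_subterms C"
  unfolding system_subterms_def using subterms_trans by blast

text \<open>What condition (1) leaves after deletion is part of the full left side, so weakening
  applies.\<close>

lemma system_monotone:
  assumes "deducibility_constraint_system C" "i < j" "j < length C" "solution \<theta> (take j C)"
    and "N \<in> subst \<theta> ` lhs (C ! i)"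
  shows "nd True (subst \<theta> ` lhs (C ! j)) N"
proof -
  have "subst \<theta> ` delete_vars (lhs (C ! j)) (lhs (C ! i)) \<turnstile> N"
    using assms unfolding deducibility_constraint_system_def by blast
  then have "subst \<theta> ` lhs (C ! j) \<turnstile> N"
    by (rule derivable_weaken) (auto simp: delete_vars_def)
  then show ?thesis by (simp add: derivable_iff_nd)
qed

text \<open>Before its originating constraint \<open>y\<close> does not occur at all. That
  constraint is thus not after \<open>i\<close>, and it is not \<open>i\<close> either, having
  \<open>y\<close> off its left side.\<close>

lemma system_origination:
  assumes "deducibility_constraint_system C" "i < length C" "y \<in> vars_set (lhs (C ! i))"
  obtains k where "k < i" "y \<in> vars (rhs (C ! k))"
proof -
  have y: "y \<in> vars_constr (C ! i)" using assms(3) by (simp add: vars_constr_def)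
  then have "y \<in> (\<Union>c\<in>set C. vars_constr c)" using assms(2) by auto
  then obtain k where k: "y \<in> vars (rhs (C ! k))" "y \<notin> vars_set (lhs (C ! k))"
      "\<forall>j<k. y \<notin> vars_constr (C ! j)"
    using assms(1) unfolding deducibility_constraint_system_def by blast
  have "\<not> i < k" using k(3) y by blast
  moreover have "k \<noteq> i" using k(2) assms(3) by blast
  ultimately show ?thesis using k(1) by (intro that[of k]) simp_all
qed

text \<open>A message that is not an instance of a non-variable subterm enters the system through the
  right side of some constraint, where it must have been composed by the intruder.  Its
  components are then derivable from there on, so that nothing is lost by replacing it.\<close>

lemma solution_replace:
  assumes sys: "deducibility_constraint_system C" and a: "\<forall>c\<in>set C. Name a \<in> lhs c"
    and sol: "solution \<theta> C" and x: "x \<in> system_vars C"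
    and t: "\<And>u. u \<in> system_subterms C \<Longrightarrow> u \<notin> range Var \<Longrightarrow> subst \<theta> u \<noteq> \<theta> x"
  shows "solution (\<lambda>y. replace (\<theta> x) (Name a) (\<theta> y)) C"
proof -
  let ?r = "replace (\<theta> x) (Name a)"
  define \<theta>' where "\<theta>' = (\<lambda>y. ?r (\<theta> y))"
  define occ where "occ i \<longleftrightarrow> i < length C \<and>
    (\<exists>m\<in>constr_msgs (C ! i). \<theta> x \<in> set (subterms (subst \<theta> m)))" for i
  \<comment> \<open>The first constraint whose instance contains \<open>\<theta> x\<close>, possibly
    through another variable.\<close>
  define k where "k = (LEAST i. occ i)"
  obtain i m where "i < length C" "m \<in> constr_msgs (C ! i)" "x \<in> vars m"
    using x by (auto simp: system_vars_def vars_constr_eq in_set_conv_nth)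
  then have "occ i"
    using subterms_subst_Var[of x m \<theta>] subterms_refl[of "\<theta> x"] unfolding occ_def by blast
  then have "\<exists>i. occ i" by blast
  then have k: "occ k" and least: "\<And>i. i < k \<Longrightarrow> \<not> occ i"
    unfolding k_def by (auto intro: LeastI_ex dest: not_less_Least)
  then have lenk: "k < length C" by (simp add: occ_def)
  have in_sys: "set (subterms m) \<subseteq> system_subterms C" if "i < length C" "m \<in> constr_msgs (C ! i)" for i m
    using that(2) nth_mem[OF that(1)] unfolding system_subterms_def by blast
  have hom: "subst \<theta>' m = ?r (subst \<theta> m)" if "i < length C" "m \<in> constr_msgs (C ! i)" for i m
    unfolding \<theta>'_def using in_sys[OF that] t by (intro subst_replace) blast
  have hom_lhs: "subst \<theta>' ` lhs (C ! i) = ?r ` subst \<theta> ` lhs (C ! i)"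
    and hom_rhs: "subst \<theta>' (rhs (C ! i)) = ?r (subst \<theta> (rhs (C ! i)))" if "i < length C" for i
    using hom[OF that] by (auto simp: constr_msgs_def image_image)
  \<comment> \<open>An occurrence on the left lies inside the value of a variable, as
    \<open>t\<close> excludes the other case; that variable occurs on an earlier right side, against
    the choice of \<open>k\<close>.\<close>
  have absent: "\<theta> x \<notin> set (subterms (subst \<theta> m))" if m: "m \<in> lhs (C ! k)" for m
  proof
    assume "\<theta> x \<in> set (subterms (subst \<theta> m))"
    moreover have "\<not> (\<exists>u\<in>set (subterms m). u \<notin> range Var \<and> \<theta> x = subst \<theta> u)"
      using in_sys[OF lenk, of m] m t by (metis constr_msgs_def insertCI subsetD)
    ultimately obtain y where y: "y \<in> vars m" "\<theta> x \<in> set (subterms (\<theta> y))"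
      using subterms_subst by blast
    then have "y \<in> vars_set (lhs (C ! k))" using m by (auto simp: vars_set_def)
    then obtain j where j: "j < k" "y \<in> vars (rhs (C ! j))"
      using system_origination[OF sys lenk] by blast
    then have "occ j"
      using y(2) subterms_subst_Var[of y "rhs (C ! j)" \<theta>] lenk
      by (auto simp: occ_def constr_msgs_def)
    with least j show False by blast
  qed
  have occ_rhs: "\<theta> x \<in> set (subterms (subst \<theta> (rhs (C ! k))))"
    using k absent by (auto simp: occ_def constr_msgs_def)
  have lhs_k: "?r ` subst \<theta> ` lhs (C ! k) = subst \<theta> ` lhs (C ! k)"
    using absent by (force simp: image_image replace_absent intro!: image_cong)
  have nd_i: "nd (is_proper (C ! i)) (subst \<theta> ` lhs (C ! i)) (subst \<theta> (rhs (C ! i)))"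
    if "i < length C" for i
    using sol that by (simp add: solution_def solves_constr_iff_nd)
  \<comment> \<open>Constraint \<open>k\<close> may be a right one; its derivation is also one with
    all rules.\<close>
  have comp_k: "nd True (subst \<theta> ` lhs (C ! k)) M \<and> nd True (subst \<theta> ` lhs (C ! k)) N"
    if "\<theta> x = Pair M N \<or> \<theta> x = Enc M N" for M N
    using nd_composed[OF nd_True[OF nd_i[OF lenk]] occ_rhs _ that] absent by blast
  have ground: "ground_subst \<theta>'"
    using sol vars_replace[of "Name a" "\<theta> x"]
    by (auto simp: solution_def ground_subst_def ground_def \<theta>'_def)
  have "solution \<theta>' (take j C)" if "j \<le> length C" for j
    using that
  proof (induction j)
    case 0
    show ?case using ground by (simp add: solution_def)
  next
    case (Suc j)
    then have j: "j < length C" and IH: "solution \<theta>' (take j C)" by simp_all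
    have "nd (is_proper (C ! j)) (?r ` subst \<theta> ` lhs (C ! j)) (?r (subst \<theta> (rhs (C ! j))))"
    proof (cases "j < k")
      case True
      have "?r (subst \<theta> m) = subst \<theta> m" if "m \<in> constr_msgs (C ! j)" for m
        using least[OF True] j that by (auto simp: occ_def intro: replace_absent)
      then have "?r ` subst \<theta> ` lhs (C ! j) = subst \<theta> ` lhs (C ! j)"
        "?r (subst \<theta> (rhs (C ! j))) = subst \<theta> (rhs (C ! j))"
        by (force simp: constr_msgs_def image_image intro!: image_cong)+
      then show ?thesis using nd_i[OF j] by simp
    next
      case False
      \<comment> \<open>The left side of \<open>k\<close> is the same under \<open>\<theta>\<close>
        and \<open>\<theta>'\<close>. Condition (1) for \<open>\<theta>'\<close> carries it to later
        constraints, and with it the components of \<open>\<theta> x\<close>.\<close>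
      have mono: "nd True (?r ` subst \<theta> ` lhs (C ! j)) m" if "m \<in> subst \<theta> ` lhs (C ! k)" for m
      proof (cases "j = k")
        case True
        then show ?thesis using that lhs_k by (simp add: nd.ax)
      next
        case False
        with \<open>\<not> j < k\<close> have "k < j" by simp
        then show ?thesis
          using system_monotone[OF sys _ j IH, of k m] that lhs_k hom_lhs j lenk by simp
      qed
      show ?thesis
      proof (rule nd_replace[OF nd_i[OF j]])
        have "Name a \<in> lhs (C ! j)" using a j by simp
        then show "Name a \<in> subst \<theta> ` lhs (C ! j)" by (metis imageI subst.simps(1))
      qed (use comp_k nd_cut[OF _ mono] in auto)
    qed
    then have "solves_constr \<theta>' (C ! j)"
      using hom_lhs[OF j] hom_rhs[OF j] by (simp add: solves_constr_iff_nd)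
    with IH show ?case by (auto simp: solution_def take_Suc_conv_app_nth[OF j])
  qed
  from this[of "length C"] show ?thesis by (simp add: \<theta>'_def)
qed

lemma finite_system_vars:
  assumes "deducibility_constraint_system C" shows "finite (system_vars C)"
proof -
  have "finite (vars m)" for m by (induction m) simp_all
  then show ?thesis
    using assms by (auto simp: deducibility_constraint_system_def system_vars_def vars_constr_def vars_set_def)
qed

lemma satisfiable_imp_standard_solution:
  assumes sys: "deducibility_constraint_system C" and a: "\<forall>c\<in>set C. Name a \<in> lhs c"
    and "satisfiable C"
  obtains \<theta> where "solution \<theta> C"
    "\<And>x. x \<in> system_vars C \<Longrightarrow> \<exists>u\<in>system_subterms C. u \<notin> range Var \<and> \<theta> x = subst \<theta> u"
proof -
  let ?w = "\<lambda>\<theta>. \<Sum>x\<in>system_vars C. weight a (\<theta> x)"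
  obtain \<theta> where sol: "solution \<theta> C" and min: "\<And>\<theta>'. solution \<theta>' C \<Longrightarrow> ?w \<theta> \<le> ?w \<theta>'"
    using assms(3) ex_has_least_nat[of "\<lambda>\<theta>. solution \<theta> C" _ ?w] unfolding satisfiable_def by blast
  have "\<exists>u\<in>system_subterms C. u \<notin> range Var \<and> \<theta> x = subst \<theta> u" if x: "x \<in> system_vars C" for x
  proof (rule ccontr)
    assume neg: "\<not> ?thesis"
    let ?\<theta> = "\<lambda>y. replace (\<theta> x) (Name a) (\<theta> y)"
    obtain c where "c \<in> set C" using x by (auto simp: system_vars_def)
    \<comment> \<open>\<open>Name a\<close> is itself an admissible value, so the offending
      \<open>\<theta> x\<close> differs from it and has positive weight.\<close>
    then have "Name a \<in> system_subterms C"
      using a by (force simp: system_subterms_def constr_msgs_def)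
    then have "\<theta> x \<noteq> Name a" using neg by force
    then have "weight a (?\<theta> x) < weight a (\<theta> x)"
      using weight_eq_0_iff[of a "\<theta> x"] by simp
    then have "?w ?\<theta> < ?w \<theta>"
      using x weight_replace by (intro sum_strict_mono_ex1 finite_system_vars[OF sys]) blast+
    moreover have "solution ?\<theta> C"
      using neg by (intro solution_replace[OF sys a sol x]) force
    ultimately show False using min by force
  qed
  with sol that show ?thesis by blast
qed

section \<open>Computing with messages\<close>

definition tag :: "msg \<Rightarrow> nat" where "tag M = fst (prod_decode (msg_code M))"
definition payload :: "msg \<Rightarrow> nat" where "payload M = snd (prod_decode (msg_code M))"

lemma tag_simps [simp]:
  "tag (Name a) = 0" "tag (Var x) = 1" "tag (Pair M N) = 2" "tag (Enc M K) = 3"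
  and payload_Var [simp]: "payload (Var x) = x"
  by (simp_all add: tag_def payload_def)

lemma tag_eq_1_iff: "tag M = 1 \<longleftrightarrow> M \<in> range Var"
  by (cases M) auto

text \<open>The code of a decoded pair is the number it was decoded from, so the identity program
  serves.\<close>

lemma computable_prod_decode [computable_intros]:
  fixes f :: "'a::encodable \<Rightarrow> nat"
  shows "computable f \<Longrightarrow> computable (\<lambda>x. prod_decode (f x))"
  by (rule computable_comp[of prod_decode], rule computableI[of "Proj 0"]) (simp_all add: encode_prod_def)

lemma computable_tag [computable_intros]: "computable f \<Longrightarrow> computable (\<lambda>x. tag (f x))"
  unfolding tag_def encode_msg_def[symmetric] by (intro computable_intros)

lemma computable_payload [computable_intros]: "computable f \<Longrightarrow> computable (\<lambda>x. payload (f x))"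
  unfolding payload_def encode_msg_def[symmetric] by (intro computable_intros)

lemma computable_msg_Pair [computable_intros]:
  assumes "computable f" "computable g" shows "computable (\<lambda>x. msg.Pair (f x) (g x))"
proof -
  have "computable (\<lambda>x. (2::nat, f x, g x))" by (intro computable_intros assms)
  then show ?thesis
    by (rule computable_transfer[where h = "\<lambda>x. x"]) (simp_all add: encode_prod_def encode_msg_def)
qed

lemma computable_Enc [computable_intros]:
  assumes "computable f" "computable g" shows "computable (\<lambda>x. Enc (f x) (g x))"
proof -
  have "computable (\<lambda>x. (3::nat, f x, g x))" by (intro computable_intros assms)
  then show ?thesis
    by (rule computable_transfer[where h = "\<lambda>x. x"]) (simp_all add: encode_prod_def encode_msg_def)
qed

fun components :: "msg \<Rightarrow> msg list" where
  "components (Pair M N) = [M, N]"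
| "components (Enc M K) = [M, K]"
| "components _ = []"

lemma computable_components [computable_intros]:
  assumes "computable f" shows "computable (\<lambda>x. components (f x))"
proof (rule computable_comp[OF _ assms])
  let ?g = "\<lambda>M. if tag M = 0 \<or> tag M = 1 then []
    else [fst (prod_decode (payload M)), snd (prod_decode (payload M))]"
  have g: "computable ?g" by (intro computable_intros)
  have eq: "encode (components M) = encode (?g M)" for M
    by (cases M) (simp_all add: encode_list_def encode_msg_def payload_def)
  show "computable components"
    by (rule computable_transfer[OF g, where h = "\<lambda>x. x"]) (rule refl, rule eq)
qed

text \<open>A step of depth-first traversal on a stack of messages to visit and the output so far;
  adding to the front of the output reverses the preorder.\<close>

definition visit :: "msg list \<times> msg list \<Rightarrow> msg list \<times> msg list" where
  "visit s = (if fst s = [] then s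
     else (components (hd (fst s)) @ tl (fst s), hd (fst s) # snd s))"

lemma visit_subterms:
  "(visit ^^ length (subterms M)) (M # todo, out) = (todo, subterms M @ out)"
  by (induction M arbitrary: todo out) (simp_all add: visit_def funpow_add funpow_swap1)

lemma length_subterms_le: "length (subterms M) \<le> Suc (msg_code M)"
proof -
  \<comment> \<open>The 3 is made up of the root and one \<open>Suc\<close> from each component; a
    tag of at least 2 leaves room for it.\<close>
  have *: "a + b + 3 \<le> Suc (prod_encode (k, prod_encode (a, b)))" if "k \<ge> 2" for k a b
  proof -
    have le: "n \<le> triangle n" for n
      by (induction n) simp_all
    show ?thesis using that le[of "a + b"] le[of "k + prod_encode (a, b)"]
      by (simp add: prod_encode_def)
  qed
  show ?thesis
  proof (induction M)
    case (Pair M N)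
    then show ?case using *[of 2 "msg_code M" "msg_code N"] by simp
  next
    case (Enc M K)
    then show ?case using *[of 3 "msg_code M" "msg_code K"] by simp
  qed simp_all
qed

lemma computable_subterms [computable_intros]:
  assumes "computable f" shows "computable (\<lambda>x. subterms (f x))"
proof (rule computable_comp[OF _ assms])
  have "(visit ^^ n) ([], out) = ([], out)" for n out
    by (induction n) (simp_all add: visit_def)
  then have "(visit ^^ (n + length (subterms M))) ([M], []) = ([], subterms M)" for n M
    by (simp add: funpow_add visit_subterms)
  then have eq: "subterms = (\<lambda>M. snd ((visit ^^ Suc (encode M)) ([M], [])))"
    using le_add_diff_inverse2[OF length_subterms_le] unfolding encode_msg_def
    by (metis (no_types) snd_conv)
  show "computable subterms"
    unfolding eq visit_def by (intro computable_intros)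
qed

text \<open>The right component precedes the left one in \<open>subterms\<close>, so the value of
  the left one is on top of the stack.\<close>

definition subst_step :: "subst \<Rightarrow> msg \<Rightarrow> msg list \<Rightarrow> msg list" where
  "subst_step \<theta> M stack =
     (if tag M = 0 then M # stack
      else if tag M = 1 then \<theta> (payload M) # stack
      else (if tag M = 2 then Pair (hd stack) (hd (tl stack))
            else Enc (hd stack) (hd (tl stack))) # tl (tl stack))"

lemma fold_subst_step: "fold (subst_step \<theta>) (subterms M) stack = subst \<theta> M # stack"
  by (induction M arbitrary: stack) (simp_all add: subst_step_def)

lemma computable_subst [computable_intros]:
  assumes \<theta>: "computable (\<lambda>w. \<theta> (fst w) (snd w))" and M: "computable M"
  shows "computable (\<lambda>z. subst (\<theta> z) (M z))"
proof -
  have eq: "subst \<theta> M = hd (fold (subst_step \<theta>) (subterms M) [])" for \<theta> M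
    by (simp add: fold_subst_step)
  have "computable (\<lambda>w. \<theta> (fst w) (payload (fst (snd w))))"
    using computable_comp[OF \<theta>, of "\<lambda>w. (fst w, payload (fst (snd w)))"]
    by (simp add: computable_intros)
  then show ?thesis
    unfolding eq subst_step_def by (intro computable_fold computable_intros M)
qed

section \<open>The decision procedure\<close>

lemma computable_comp2:
  assumes "computable (\<lambda>p. f (fst p) (snd p))" "computable a" "computable b"
  shows "computable (\<lambda>z. f (a z) (b z))"
  using computable_comp[OF assms(1) computable_Pair[OF assms(2,3)]] by simp

definition nd_step_list :: "bool \<Rightarrow> msg list \<Rightarrow> msg list \<Rightarrow> msg list \<Rightarrow> msg list" where
  "nd_step_list d G U X = filter (\<lambda>M. M \<in> set G \<or>
     (\<exists>v\<in>set X. \<exists>w\<in>set X. M = Pair v w \<or> M = Enc v w) \<or>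
     d \<and> (\<exists>v\<in>set X. \<exists>w\<in>set U. v = Pair M w \<or> v = Pair w M \<or> v = Enc M w \<and> w \<in> set X)) U"

lemma set_nd_step_list: "set (nd_step_list d G U X) = nd_step d (set G) (set U) (set X)"
  unfolding nd_step_list_def nd_step_def by simp

definition all_subterms :: "msg list \<Rightarrow> msg list" where
  "all_subterms Ms = concat (map subterms Ms)"

lemma set_all_subterms: "set (all_subterms Ms) = (\<Union>M\<in>set Ms. set (subterms M))"
  by (simp add: all_subterms_def)

lemma computable_all_subterms [computable_intros]:
  "computable f \<Longrightarrow> computable (\<lambda>x. all_subterms (f x))"
  unfolding all_subterms_def by (intro computable_intros)

definition derives :: "bool \<Rightarrow> msg list \<Rightarrow> msg \<Rightarrow> bool" where
  "derives d G M \<longleftrightarrow> M \<in> set ((nd_step_list d G (all_subterms (M # G)) ^^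
     length (all_subterms (M # G))) [])"

lemma subterms_components:
  "Pair M N \<in> set (subterms T) \<or> Enc M N \<in> set (subterms T) \<Longrightarrow>
    M \<in> set (subterms T) \<and> N \<in> set (subterms T)"
  by (induction T) auto

lemma derives_iff_nd: "derives d G M \<longleftrightarrow> nd d (set G) M"
proof -
  let ?U = "all_subterms (M # G)"
  have "set ((nd_step_list d G ?U ^^ n) []) = (nd_step d (set G) (set ?U) ^^ n) {}" for n
    by (induction n) (simp_all add: set_nd_step_list)
  moreover have "closed_under_components (set ?U)"
    unfolding closed_under_components_def set_all_subterms using subterms_components by blast
  moreover have "set G \<subseteq> set ?U" "M \<in> set ?U"
    by (auto simp: set_all_subterms)
  ultimately show ?thesis
    using nd_local[of "set ?U" "set G" M "length ?U" d] card_length[of ?U]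
    by (simp add: derives_def)
qed

lemma computable_derives [computable_intros]:
  assumes "computable d" "computable G" "computable M"
  shows "computable (\<lambda>z. derives (d z) (G z) (M z))"
proof -
  have "computable (\<lambda>p. derives (fst p) (fst (snd p)) (snd (snd p)))"
    unfolding derives_def nd_step_list_def by (intro computable_intros)
  from computable_comp[OF this computable_Pair[OF assms(1) computable_Pair[OF assms(2,3)]]]
  show ?thesis by simp
qed

text \<open>A total \<open>map_of\<close>, written as a \<open>foldr\<close> so that the closure
  rules apply. The default is ground, so the empty list already denotes a ground
  substitution.\<close>

definition look :: "(nat \<times> msg) list \<Rightarrow> subst" where
  "look A x = foldr (\<lambda>p M. if fst p = x then snd p else M) A (Name 0)"

lemma look_simps [simp]:
  "look [] x = Name 0" "look (p # A) x = (if fst p = x then snd p else look A x)"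
  by (simp_all add: look_def)

lemma computable_look [computable_intros]:
  assumes "computable A" "computable x"
  shows "computable (\<lambda>z. look (A z) (x z))"
  by (rule computable_comp2[where f = look, OF _ assms]) (unfold look_def, intro computable_intros)

lemma look_map: "x \<in> set xs \<Longrightarrow> look (map (\<lambda>x. (x, s x)) xs) x = s x"
  by (induction xs) auto

definition refine :: "(nat \<times> msg) list \<Rightarrow> (nat \<times> msg) list \<Rightarrow> (nat \<times> msg) list" where
  "refine \<sigma> A = map (\<lambda>p. (fst p, subst (look A) (snd p))) \<sigma>"

text \<open>This includes \<open>x\<close> outside \<open>\<sigma>\<close>: the default
  \<open>Name 0\<close> is its own instance.\<close>

lemma look_refine: "look (refine \<sigma> A) x = subst (look A) (look \<sigma> x)"
  by (induction \<sigma>) (simp_all add: refine_def)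

text \<open>An acyclic assignment to \<open>n\<close> variables is resolved by \<open>n\<close> rounds of substitution; cycles
  are cut off by the default value of \<open>look\<close>.\<close>

definition resolve :: "(nat \<times> msg) list \<Rightarrow> (nat \<times> msg) list" where
  "resolve \<sigma> = (refine \<sigma> ^^ length \<sigma>) []"

lemma computable_resolve [computable_intros]:
  assumes "computable f" shows "computable (\<lambda>x. resolve (f x))"
  by (rule computable_comp[OF _ assms]) (unfold resolve_def refine_def, intro computable_intros)

lemma vars_subst: "vars (subst \<theta> M) = (\<Union>x\<in>vars M. vars (\<theta> x))"
  by (induction M) auto

lemma subst_cong: "(\<And>x. x \<in> vars M \<Longrightarrow> \<theta> x = \<theta>' x) \<Longrightarrow> subst \<theta> M = subst \<theta>' M"
  by (induction M) auto

text \<open>Even for a cyclic \<open>\<sigma>\<close>: the iteration starts with a constant ground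
  substitution, and each round puts ground values for all variables. Candidates thus require no
  check for acyclicity.\<close>

lemma ground_subst_resolve: "ground_subst (look (resolve \<sigma>))"
proof -
  have "vars (look ((refine \<sigma> ^^ n) []) x) = {}" for n x
    by (induction n arbitrary: x) (simp_all add: look_refine vars_subst)
  then show ?thesis by (simp add: resolve_def ground_subst_def ground_def)
qed

text \<open>As \<open>s x\<close> is not a variable, the values of its variables are smaller than
  \<open>\<theta> x\<close>. Progress is measured by \<open>rank\<close> rather than size because it
  stays below the number \<open>length V\<close> of rounds: after \<open>n\<close> rounds all
  variables of rank below \<open>n\<close> are correct.\<close>

lemma look_resolve:
  assumes s: "\<And>x. x \<in> set V \<Longrightarrow> s x \<notin> range Var \<and> vars (s x) \<subseteq> set V \<and> \<theta> x = subst \<theta> (s x)"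
    and x: "x \<in> set V"
  shows "look (resolve (map (\<lambda>x. (x, s x)) V)) x = \<theta> x"
proof -
  let ?\<sigma> = "map (\<lambda>x. (x, s x)) V"
  define rank where "rank x = card {y \<in> set V. size (\<theta> y) < size (\<theta> x)}" for x
  have smaller: "size (\<theta> y) < size (\<theta> x)" if "x \<in> set V" "y \<in> vars (s x)" for x y
  proof -
    have le: "size (\<theta> y) \<le> size (subst \<theta> M)" if "y \<in> vars M" for M
      using subterms_subst_Var[OF that, of \<theta>] subterms_refl[of "\<theta> y"] size_subterms by blast
    have "size (\<theta> y) < size (subst \<theta> (s x))"
      using that s[OF that(1)] le by (cases "s x") (auto simp: less_Suc_eq_le intro: trans_le_add1 trans_le_add2)
    then show ?thesis using s[OF that(1)] by simp
  qed
  have less: "rank y < rank x" if "size (\<theta> y) < size (\<theta> x)" "y \<in> set V" for x y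
    unfolding rank_def using that by (intro psubset_card_mono) auto
  have "look ((refine ?\<sigma> ^^ n) []) x = \<theta> x" if "x \<in> set V" "rank x < n" for n x
    using that
  proof (induction n arbitrary: x)
    case (Suc n)
    have "look ((refine ?\<sigma> ^^ n) []) y = \<theta> y" if y: "y \<in> vars (s x)" for y
    proof -
      have "y \<in> set V" using s[OF Suc.prems(1)] y by blast
      with less[OF smaller[OF Suc.prems(1) y]] Suc.prems(2) show ?thesis
        by (intro Suc.IH) simp_all
    qed
    then have "subst (look ((refine ?\<sigma> ^^ n) [])) (s x) = subst \<theta> (s x)"
      by (rule subst_cong)
    with s[OF Suc.prems(1)] show ?case
      by (simp add: look_refine look_map[OF Suc.prems(1)])
  qed simp
  moreover have "rank x < length V"
  proof -
    have "rank x < card (set V)" unfolding rank_def using x by (intro psubset_card_mono) auto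
    with card_length[of V] show ?thesis by simp
  qed
  ultimately show ?thesis using x by (simp add: resolve_def)
qed

text \<open>If \<open>V\<close> repeats a variable, lists giving it several values arise as well;
  \<open>look\<close> reads the first, and such lists are merely further candidates.\<close>

definition assignments :: "nat list \<Rightarrow> msg list \<Rightarrow> (nat \<times> msg) list list" where
  "assignments V T = foldr (\<lambda>x As. concat (map (\<lambda>M. map (\<lambda>A. (x, M) # A) As) T)) V [[]]"

lemma map_in_assignments:
  "(\<And>x. x \<in> set V \<Longrightarrow> s x \<in> set T) \<Longrightarrow> map (\<lambda>x. (x, s x)) V \<in> set (assignments V T)"
  by (induction V) (auto simp: assignments_def)

lemma computable_assignments [computable_intros]:
  assumes "computable V" "computable T"
  shows "computable (\<lambda>z. assignments (V z) (T z))"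
  by (rule computable_comp2[where f = assignments, OF _ assms])
    (unfold assignments_def, intro computable_intros)

text \<open>A constraint is represented by the triple of its kind (0 for proper, 1 for right), the
  list of its hypotheses and its conclusion.\<close>

type_synonym listed_constr = "nat \<times> msg list \<times> msg"

definition listed_subterms :: "listed_constr list \<Rightarrow> msg list" where
  "listed_subterms L = all_subterms (concat (map (\<lambda>c. snd (snd c) # fst (snd c)) L))"

definition decide :: "listed_constr list \<Rightarrow> bool" where
  "decide L \<longleftrightarrow> (\<exists>\<sigma>\<in>set (assignments
       (map payload (filter (\<lambda>M. tag M = 1) (listed_subterms L)))
       (filter (\<lambda>M. tag M \<noteq> 1) (listed_subterms L))).
     \<forall>c\<in>set L. derives (fst c = 0)
       (map (subst (look (resolve \<sigma>))) (fst (snd c)))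
       (subst (look (resolve \<sigma>)) (snd (snd c))))"

lemma computable_decide: "computable decide"
  unfolding decide_def listed_subterms_def by (intro computable_intros)

text \<open>The order of the elements is fixed by the code of the set, so the list can be computed
  from that code.\<close>

definition listing :: "msg set \<Rightarrow> msg list" where
  "listing S = map (inv msg_code) (bits (set_encode (msg_code ` S)))"

lemma bits_set_encode: "finite S \<Longrightarrow> set (bits (set_encode (msg_code ` S))) = msg_code ` S"
  by (simp add: set_bits)

lemma set_listing: "finite S \<Longrightarrow> set (listing S) = S"
  by (simp add: listing_def bits_set_encode image_image inj_msg_code)

lemma encode_listing:
  assumes "finite S" shows "encode (listing S) = list_encode (bits (set_encode (msg_code ` S)))"
proof -
  have "map (msg_code \<circ> inv msg_code) (bits (set_encode (msg_code ` S))) =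
      bits (set_encode (msg_code ` S))"
    by (rule map_idI) (use bits_set_encode[OF assms] in \<open>auto simp: inj_msg_code\<close>)
  then show ?thesis by (simp add: encode_list_def encode_msg_def listing_def)
qed

definition listed :: "constr \<Rightarrow> listed_constr" where
  "listed c = (if is_proper c then 0 else 1, listing (lhs c), rhs c)"

lemma listed_simps [simp]:
  "fst (listed c) = 0 \<longleftrightarrow> is_proper c" "fst (snd (listed c)) = listing (lhs c)"
  "snd (snd (listed c)) = rhs c"
  by (simp_all add: listed_def)

text \<open>Not phrased with \<open>computable\<close>, since \<open>constr_code\<close> is
  injective only on constraints with finite left sides. The program stays with numbers: it expands
  set codes by \<open>bits\<close> and keeps message codes as they are.\<close>

lemma listed_code_computable:
  "\<exists>r. \<forall>C. (\<forall>c\<in>set C. finite (lhs c)) \<longrightarrow>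
    run r [system_code C] = Some (encode (map listed C))"
proof -
  let ?f = "\<lambda>L. map (\<lambda>c. (fst c, bits (fst (snd c)), snd (snd c))) L :: (nat \<times> nat list \<times> nat) list"
  let ?g = "\<lambda>c. (if is_proper c then 0 else 1, set_encode (msg_code ` lhs c), msg_code (rhs c)) ::
    nat \<times> nat \<times> nat"
  have "computable ?f" by (intro computable_intros)
  then obtain r where r: "\<And>L. run r [encode L] = Some (encode (?f L))"
    unfolding computable_def by blast
  have "constr_code c = encode (?g c)" for c
    by (cases c) (simp_all add: encode_prod_def)
  then have code: "system_code C = encode (map ?g C)" for C
    by (simp add: system_code_def encode_list_def cong: map_cong)
  have "run r [system_code C] = Some (encode (map listed C))" if "\<forall>c\<in>set C. finite (lhs c)" for C
  proof -
    have "encode ns = list_encode ns" for ns :: "nat list"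
      by (simp add: encode_list_def cong: map_cong)
    then have "encode (fst (?g c), bits (fst (snd (?g c))), snd (snd (?g c))) = encode (listed c)"
      if "c \<in> set C" for c
      using that \<open>\<forall>c\<in>set C. finite (lhs c)\<close>
      by (simp add: listed_def encode_prod_def encode_listing encode_msg_def)
    then have "encode (?f (map ?g C)) = encode (map listed C)"
      by (simp add: encode_list_def list_encode_eq)
    with r[of "map ?g C"] show ?thesis by (simp only: code)
  qed
  then show ?thesis by blast
qed

text \<open>Every candidate is ground and tested in full, which gives soundness. The name
  \<open>a\<close> is no input of \<open>decide\<close>; it enters only through the standard
  solution that yields completeness.\<close>

lemma decide_iff_satisfiable:
  assumes sys: "deducibility_constraint_system C" and a: "\<forall>c\<in>set C. Name a \<in> lhs c"
  shows "decide (map listed C) \<longleftrightarrow> satisfiable C"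
proof -
  have fin: "finite (lhs c)" if "c \<in> set C" for c
    using sys that by (simp add: deducibility_constraint_system_def)
  let ?S = "listed_subterms (map listed C)"
  let ?V = "map payload (filter (\<lambda>M. tag M = 1) ?S)" and ?T = "filter (\<lambda>M. tag M \<noteq> 1) ?S"
  have S: "set ?S = system_subterms C"
    by (auto simp: listed_subterms_def set_all_subterms system_subterms_def
        constr_msgs_def set_listing[OF fin])
  have V: "set ?V = system_vars C"
    unfolding system_vars_eq S[symmetric]
    by (force simp: tag_eq_1_iff[simplified])
  have solves: "(\<forall>c\<in>set (map listed C). derives (fst c = 0) (map (subst \<theta>) (fst (snd c)))
      (subst \<theta> (snd (snd c)))) \<longleftrightarrow> (\<forall>c\<in>set C. solves_constr \<theta> c)" for \<theta>
    by (simp add: derives_iff_nd set_listing[OF fin] solves_constr_iff_nd)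
  show ?thesis
  proof
    assume "decide (map listed C)"
    then obtain \<sigma> where "\<forall>c\<in>set C. solves_constr (look (resolve \<sigma>)) c"
      unfolding decide_def solves by blast
    then show "satisfiable C"
      using ground_subst_resolve unfolding satisfiable_def solution_def by blast
  next
    assume "satisfiable C"
    then obtain \<theta> where sol: "solution \<theta> C"
      and std: "\<And>x. x \<in> system_vars C \<Longrightarrow>
        \<exists>u\<in>system_subterms C. u \<notin> range Var \<and> \<theta> x = subst \<theta> u"
      using satisfiable_imp_standard_solution[OF sys a] by blast
    then obtain s where s: "\<And>x. x \<in> system_vars C \<Longrightarrow>
        s x \<in> system_subterms C \<and> s x \<notin> range Var \<and> \<theta> x = subst \<theta> (s x)"
      by metis
    let ?\<sigma> = "map (\<lambda>x. (x, s x)) ?V"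
    have "?\<sigma> \<in> set (assignments ?V ?T)"
      by (rule map_in_assignments) (use s V S tag_eq_1_iff in auto)
    moreover have "look (resolve ?\<sigma>) x = \<theta> x" if "x \<in> system_vars C" for x
    proof (rule look_resolve)
      show "x \<in> set ?V" using that V by simp
      fix y assume "y \<in> set ?V"
      then have y: "y \<in> system_vars C" using V by simp
      have "vars (s y) \<subseteq> system_vars C"
        using s[OF y] subterms_system_subterms[of "Var _" "s y" C] by (auto simp: system_vars_eq)
      then show "s y \<notin> range Var \<and> vars (s y) \<subseteq> set ?V \<and> \<theta> y = subst \<theta> (s y)"
        using s[OF y] V by simp
    qed
    \<comment> \<open>The two substitutions may differ elsewhere, but the constraints contain only
      variables of the system.\<close>
    then have eq: "subst (look (resolve ?\<sigma>)) M = subst \<theta> M" if "c \<in> set C" "M \<in> constr_msgs c" for c M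
      using that by (intro subst_cong) (auto simp: system_vars_def vars_constr_eq)
    have "solves_constr (look (resolve ?\<sigma>)) c" if c: "c \<in> set C" for c
    proof -
      have "subst (look (resolve ?\<sigma>)) ` lhs c = subst \<theta> ` lhs c"
        "subst (look (resolve ?\<sigma>)) (rhs c) = subst \<theta> (rhs c)"
        using eq[OF c] by (auto simp: constr_msgs_def)
      then show ?thesis using sol c by (simp add: solution_def solves_constr_iff_nd)
    qed
    ultimately show "decide (map listed C)"
      unfolding decide_def solves by blast
  qed
qed

theorem theorem6p13:
  "\<exists>alg :: recf. \<forall>C :: constr list.
     deducibility_constraint_system C \<longrightarrow>
     (\<exists>a. \<forall>c\<in>set C. Name a \<in> lhs c) \<longrightarrow>
     run alg [system_code C] = Some (if satisfiable C then 1 else 0)"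
proof -
  obtain r where r: "\<And>L. run r [encode L] = Some (encode (decide L))"
    using computable_decide unfolding computable_def by blast
  obtain r' where r': "\<And>C. \<forall>c\<in>set C. finite (lhs c) \<Longrightarrow>
      run r' [system_code C] = Some (encode (map listed C))"
    using listed_code_computable by blast
  have "run (Comp r [r']) [system_code C] = Some (if satisfiable C then 1 else 0)"
    if sys: "deducibility_constraint_system C" and a: "\<forall>c\<in>set C. Name a \<in> lhs c" for C a
  proof -
    have "\<forall>c\<in>set C. finite (lhs c)"
      using sys by (simp add: deducibility_constraint_system_def)
    then show ?thesis
      by (simp add: r r' decide_iff_satisfiable[OF sys a] encode_bool_def)
  qed
  then show ?thesis by blast
qed

end
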